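(* For $t\in\{6,10\}$ and all sufficiently large $X$, \[ \#\{n\le X:\ b_t(n)\text{ is even}\}\gg \sqrt{X}. \]
   Context: For an integer $t\ge 2$, $b_t(n)$ is the number of partitions of $n$ none of whose parts is divisible by $t$; equivalently $\sum_{n\ge0}b_t(n)q^n=f_t/f_1$ with $f_k=\prod_{j\ge1}(1-q^{jk})$. Here $n$ ranges over nonnegative integers and $\gg$ means bounded below by a positive constant times the right-hand side. *)

theory Defs
  imports Complex_Main "HOL-Library.Multiset"
begin

definition regular_partitions :: "nat \<Rightarrow> nat \<Rightarrow> nat multiset set" where
  "regular_partitions t n =
     {p. (\<forall>k \<in># p. 0 < k \<and> \<not> t dvd k) \<and> sum_mset p = n}"

definition num_regular_partitions :: "nat \<Rightarrow> nat \<Rightarrow> nat" where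
  "num_regular_partitions t n = card (regular_partitions t n)"

text \<open>The set is finite, so \<^term>\<open>card\<close> really counts the partitions.\<close>

lemma finite_regular_partitions: "finite (regular_partitions t n)"
proof -
  have size_le: "size p \<le> sum_mset p" if "\<forall>k \<in># p. 0 < k" for p :: "nat multiset"
    using that by (induction p) auto
  have "regular_partitions t n \<subseteq> mset ` {xs. set xs \<subseteq> {..n} \<and> length xs \<le> n}"
  proof
    fix p assume p: "p \<in> regular_partitions t n"
    obtain xs where xs: "mset xs = p" by (metis ex_mset)
    have "size p \<le> n" using size_le[of p] p by (auto simp: regular_partitions_def)
    hence "length xs \<le> n" using xs by auto
    moreover have "set xs \<subseteq> {..n}"
    proof
      fix k assume "k \<in> set xs"
      hence "k \<in># p" using xs by auto
      hence "k \<le> sum_mset p" by (auto dest: multi_member_split)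
      thus "k \<in> {..n}" using p by (simp add: regular_partitions_def)
    qed
    ultimately show "p \<in> mset ` {xs. set xs \<subseteq> {..n} \<and> length xs \<le> n}" using xs by blast
  qed
  thus ?thesis using finite_lists_length_le[of "{..n}" n] finite_surj by blast
qed

end

theory Submission
  imports Defs "HOL-Computational_Algebra.Formal_Power_Series" "HOL-Library.Nat_Bijection"
begin

text \<open>
  Write \<open>B\<close> for the generating function of \<open>b\<^sub>t\<close>. The series \<open>f\<^sub>1 B = f\<^sub>t\<close> is supported on the
  multiples of \<open>t\<close>, so by the pentagonal number theorem the signed sum of \<open>b\<^sub>t(n - w)\<close> over the
  generalized pentagonal numbers \<open>w \<le> n\<close> vanishes whenever \<open>t\<close> does not divide \<open>n\<close>. If moreover the
  number of such \<open>w\<close> is odd, then some \<open>b\<^sub>t(n - w)\<close> must be even. A positive proportion of the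
  \<open>n \<le> X\<close> satisfy both conditions, and each even value accounts for at most as many of them as
  there are pentagonal numbers up to \<open>X\<close>, which is of order \<open>sqrt X\<close>.
\<close>

section \<open>The pentagonal number theorem\<close>

text \<open>
  The generalized pentagonal numbers in increasing order: \<open>k (3 k + 1) / 2\<close> at the index \<open>2 k\<close>
  and \<open>(k + 1) (3 k + 2) / 2\<close> at the index \<open>2 k + 1\<close>.
\<close>

definition pentagonal :: "nat \<Rightarrow> nat" where
  "pentagonal i = (Suc i div 2)\<^sup>2 + triangle (i div 2)"

lemma pentagonal_even: "pentagonal (2 * k) = k\<^sup>2 + triangle k"
  by (simp add: pentagonal_def)

lemma pentagonal_odd: "pentagonal (Suc (2 * k)) = (Suc k)\<^sup>2 + triangle k"
  by (simp add: pentagonal_def)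

text \<open>The gap is \<open>2 k + 1\<close> after the index \<open>2 k\<close> and
  \<open>k + 1\<close> after the index \<open>2 k + 1\<close>.\<close>

lemma strict_mono_pentagonal: "strict_mono pentagonal"
proof (rule strict_mono_Suc_iff[THEN iffD2], rule allI)
  fix i
  show "pentagonal i < pentagonal (Suc i)"
  proof (cases "even i")
    case True
    then obtain k where "i = 2 * k" by blast
    thus ?thesis by (simp add: pentagonal_even pentagonal_odd power2_eq_square)
  next
    case False
    then obtain k where k: "i = Suc (2 * k)" by (metis oddE Suc_eq_plus1)
    have "pentagonal (Suc i) = pentagonal (2 * Suc k)" by (simp add: k)
    thus ?thesis by (simp only: k pentagonal_even pentagonal_odd) simp
  qed
qed

text \<open>For \<open>k \<le> n\<close> this is the q-Pochhammer quotient (q;q)_n / (q;q)_k,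
  written without division so that it makes sense over any commutative ring.\<close>

definition qprod :: "nat \<Rightarrow> nat \<Rightarrow> 'a::comm_ring_1 fps" where
  "qprod k n = (\<Prod>j\<in>{k<..n}. 1 - fps_X ^ j)"

lemma qprod_Suc_right: "k \<le> n \<Longrightarrow> qprod k (Suc n) = qprod k n * (1 - fps_X ^ Suc n)"
proof -
  assume "k \<le> n"
  hence "{k<..Suc n} = insert (Suc n) {k<..n}" by auto
  thus ?thesis by (simp add: qprod_def mult.commute)
qed

lemma qprod_Suc_left: "k < n \<Longrightarrow> (1 - fps_X ^ Suc k) * qprod (Suc k) n = qprod k n"
proof -
  assume "k < n"
  hence "{k<..n} = insert (Suc k) {Suc k<..n}" by auto
  thus ?thesis by (simp add: qprod_def)
qed

text \<open>
  Shanks' finite form of the theorem: the sum of these terms over \<open>k \<le> n\<close> is exactly the truncated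
  pentagonal series, while modulo \<open>q\<^sup>n\<^sup>+\<^sup>1\<close> only the term \<open>k = 0\<close>, the product itself, survives.
\<close>

definition shanks_term :: "nat \<Rightarrow> nat \<Rightarrow> 'a::comm_ring_1 fps" where
  "shanks_term n k = (-1) ^ k * qprod k n * fps_X ^ (k * n + triangle k)"

lemma shanks_term_Suc:
  assumes "k \<le> n"
  shows "shanks_term (Suc n) k = (1 - fps_X ^ Suc n) * fps_X ^ k * shanks_term n k"
proof -
  have "k * Suc n + triangle k = k + (k * n + triangle k)" by simp
  thus ?thesis
    by (simp only: shanks_term_def qprod_Suc_right[OF assms] power_add[of _ k] ac_simps)
qed

lemma shanks_term_step:
  assumes "k < n"
  shows "(1 - fps_X ^ Suc k) * shanks_term n (Suc k) = - (fps_X ^ (Suc n + k) * shanks_term n k)"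
proof -
  have "(1 - fps_X ^ Suc k) * shanks_term n (Suc k)
      = (-1) ^ Suc k * ((1 - fps_X ^ Suc k) * qprod (Suc k) n) * fps_X ^ (Suc k * n + triangle (Suc k))"
    unfolding shanks_term_def by (simp only: ac_simps)
  also have "\<dots> = (-1) ^ Suc k * qprod k n * fps_X ^ ((Suc n + k) + (k * n + triangle k))"
    by (simp only: qprod_Suc_left[OF assms]) (simp add: algebra_simps)
  also have "\<dots> = - (fps_X ^ (Suc n + k) * shanks_term n k)"
    unfolding shanks_term_def power_add[of _ "Suc n + k"] by simp
  finally show ?thesis .
qed

text \<open>By \<open>shanks_term_step\<close>, the first part of each summand cancels the second
  part of its predecessor; the first part vanishes at \<open>k = 0\<close>, so only the final second
  part remains.\<close>

lemma shanks_telescope: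
  assumes "m \<le> n"
  shows "(\<Sum>k\<le>m. (fps_X ^ k - 1) * shanks_term n k - fps_X ^ (Suc n + k) * shanks_term n k)
       = - (fps_X ^ (Suc n + m) * (shanks_term n m :: 'a::comm_ring_1 fps))"
  using assms
proof (induction m)
  case (Suc m)
  have "(fps_X ^ Suc m - 1) * shanks_term n (Suc m)
      = (fps_X ^ (Suc n + m) * (shanks_term n m :: 'a fps))"
    using shanks_term_step[of m n, where 'a='a] Suc.prems
    by (simp only: Suc_le_eq) (simp add: algebra_simps)
  thus ?case using Suc by (simp del: power_Suc)
qed simp

text \<open>Passing from \<open>n\<close> to \<open>n + 1\<close> adds exactly two pentagonal terms:
  index \<open>2 n + 1\<close> from the boundary of the telescoping sum, and index
  \<open>2 n + 2\<close> from the new summand \<open>k = n + 1\<close>.\<close>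

lemma sum_shanks_terms:
  "(\<Sum>k\<le>n. shanks_term n k)
   = (\<Sum>i\<le>2 * n. (-1) ^ (Suc i div 2) * fps_X ^ pentagonal i :: 'a::comm_ring_1 fps)"
proof (induction n)
  case 0
  show ?case by (simp add: shanks_term_def qprod_def pentagonal_def)
next
  case (Suc n)
  have "(\<Sum>k\<le>Suc n. shanks_term (Suc n) k :: 'a fps)
      = shanks_term (Suc n) (Suc n) + (\<Sum>k\<le>n. (1 - fps_X ^ Suc n) * fps_X ^ k * shanks_term n k)"
    by (simp add: shanks_term_Suc)
  \<comment> \<open>The factor \<open>(1 - q^(n+1)) q^k\<close> is split as
    \<open>1 + ((q^k - 1) - q^(n+1+k))\<close>; the bracket gives the telescoping sum.\<close>
  also have "(\<Sum>k\<le>n. (1 - fps_X ^ Suc n) * fps_X ^ k * shanks_term n k)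
      = (\<Sum>k\<le>n. shanks_term n k) +
        (\<Sum>k\<le>n. (fps_X ^ k - 1) * shanks_term n k - fps_X ^ (Suc n + k) * (shanks_term n k :: 'a fps))"
    unfolding sum.distrib[symmetric]
    by (intro sum.cong refl) (simp add: algebra_simps power_add)
  also have "\<dots> = (\<Sum>k\<le>n. shanks_term n k) - fps_X ^ (Suc n + n) * shanks_term n n"
    by (simp only: shanks_telescope[OF order_refl]) simp
  also have "fps_X ^ (Suc n + n) * shanks_term n n
      = (-1) ^ n * (fps_X ^ pentagonal (Suc (2 * n)) :: 'a fps)"
  proof -
    have "pentagonal (Suc (2 * n)) = (Suc n + n) + (n * n + triangle n)"
      unfolding pentagonal_odd by (simp add: power2_eq_square)
    thus ?thesis
      by (simp only: shanks_term_def qprod_def power_add[of _ "Suc n + n"])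
        (simp add: mult.left_commute)
  qed
  also have "shanks_term (Suc n) (Suc n) = (-1) ^ Suc n * (fps_X ^ pentagonal (2 * Suc n) :: 'a fps)"
    unfolding pentagonal_even by (simp add: shanks_term_def qprod_def power2_eq_square)
  finally show ?case by (simp add: Suc)
qed

theorem pentagonal_number_theorem_trunc:
  assumes "i \<le> n"
  shows "fps_nth (\<Prod>j\<in>{0<..n}. 1 - fps_X ^ j) i
       = fps_nth (\<Sum>i\<le>2 * n. (-1) ^ (Suc i div 2) * fps_X ^ pentagonal i :: 'a::comm_ring_1 fps) i"
proof -
  have "fps_nth (shanks_term n k :: 'a fps) i = 0" if "k \<noteq> 0" for k
  proof -
    from that obtain k' where k: "k = Suc k'" by (cases k) auto
    have "i < k * n + triangle k" using assms by (simp add: k)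
    thus ?thesis by (simp add: shanks_term_def fps_X_power_mult_right_nth)
  qed
  hence "(\<Sum>k\<le>n. fps_nth (shanks_term n k :: 'a fps) i) = (\<Sum>k\<in>{0}. fps_nth (shanks_term n k) i)"
    by (intro sum.mono_neutral_right) auto
  thus ?thesis
    by (simp add: sum_shanks_terms[symmetric] fps_sum_nth) (simp add: shanks_term_def qprod_def)
qed

section \<open>Generating functions of restricted partitions\<close>

definition partitions_in :: "nat set \<Rightarrow> nat \<Rightarrow> nat multiset set" where
  "partitions_in A n = {p. set_mset p \<subseteq> A \<and> sum_mset p = n}"

lemma finite_partitions_in:
  assumes "0 \<notin> A"
  shows "finite (partitions_in A n)"
proof (rule finite_subset[OF _ finite_regular_partitions])
  \<comment> \<open>Only 0 is divisible by 0, so \<open>regular_partitions 0 n\<close> consists of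
    all partitions of \<open>n\<close>.\<close>
  show "partitions_in A n \<subseteq> regular_partitions 0 n"
    using assms by (auto simp: partitions_in_def regular_partitions_def intro: Nat.gr0I)
qed

text \<open>Partitions are split by whether \<open>a\<close> occurs; removing one copy of
  \<open>a\<close> maps those containing it bijectively onto the partitions of \<open>n - a\<close>
  over the same enlarged set.\<close>

lemma card_partitions_in_insert:
  assumes "0 \<notin> A" "a \<notin> A" "a > 0"
  shows "card (partitions_in (insert a A) n)
       = card (partitions_in A n) + (if a \<le> n then card (partitions_in (insert a A) (n - a)) else 0)"
proof -
  let ?with = "{p \<in> partitions_in (insert a A) n. a \<in># p}"
  have fin: "finite (partitions_in (insert a A) n)"
    using assms by (intro finite_partitions_in) auto
  have split: "partitions_in (insert a A) n = partitions_in A n \<union> ?with"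
    by (auto simp: partitions_in_def)
  have disj: "partitions_in A n \<inter> ?with = {}"
    using assms by (auto simp: partitions_in_def)
  have "?with = (if a \<le> n then add_mset a ` partitions_in (insert a A) (n - a) else {})"
  proof (intro set_eqI iffI)
    fix p assume p: "p \<in> ?with"
    then obtain q where q: "p = add_mset a q" by (blast dest: multi_member_split)
    show "p \<in> (if a \<le> n then add_mset a ` partitions_in (insert a A) (n - a) else {})"
      using p by (auto simp: q partitions_in_def)
  next
    fix p assume "p \<in> (if a \<le> n then add_mset a ` partitions_in (insert a A) (n - a) else {})"
    thus "p \<in> ?with" by (auto simp: partitions_in_def split: if_splits)
  qed
  hence "card ?with = (if a \<le> n then card (partitions_in (insert a A) (n - a)) else 0)"
    by (auto simp: card_image inj_on_def)
  moreover have "card (partitions_in (insert a A) n) = card (partitions_in A n) + card ?with"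
    using fin disj split by (metis (no_types, lifting) card_Un_disjoint finite_Un)
  ultimately show ?thesis by simp
qed

definition partitions_fps :: "nat set \<Rightarrow> 'a::comm_ring_1 fps" where
  "partitions_fps A = Abs_fps (\<lambda>n. of_nat (card (partitions_in A n)))"

lemma partitions_fps_insert:
  assumes "0 \<notin> A" "a \<notin> A" "a > 0"
  shows "(1 - fps_X ^ a) * partitions_fps (insert a A) = (partitions_fps A :: 'a::comm_ring_1 fps)"
proof (rule fps_ext)
  fix n
  show "fps_nth ((1 - fps_X ^ a) * partitions_fps (insert a A)) n = fps_nth (partitions_fps A :: 'a fps) n"
    using card_partitions_in_insert[OF assms, of n]
    by (simp add: partitions_fps_def left_diff_distrib fps_X_power_mult_nth)
qed

lemma prod_mult_partitions_fps:
  assumes "finite A" "0 \<notin> A"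
  shows "(\<Prod>a\<in>A. 1 - fps_X ^ a) * partitions_fps A = (1 :: 'a::comm_ring_1 fps)"
  using assms
proof (induction A rule: finite_induct)
  case empty
  have "partitions_in {} n = (if n = 0 then {{#}} else {})" for n
    by (auto simp: partitions_in_def)
  thus ?case by (auto simp: partitions_fps_def fps_eq_iff)
next
  case (insert a A)
  have "(\<Prod>a\<in>insert a A. 1 - fps_X ^ a) * partitions_fps (insert a A)
      = (\<Prod>a\<in>A. 1 - fps_X ^ a) * ((1 - fps_X ^ a) * (partitions_fps (insert a A) :: 'a fps))"
    using insert.hyps by (simp add: ac_simps)
  also have "(1 - fps_X ^ a) * partitions_fps (insert a A) = (partitions_fps A :: 'a fps)"
    using insert by (intro partitions_fps_insert) auto
  finally show ?case using insert by simp
qed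

text \<open>No part exceeds the sum \<open>n\<close>. The common bound \<open>N\<close> lets one
  finite product serve all coefficients up to \<open>N\<close>.\<close>

lemma regular_partitions_eq_partitions_in:
  assumes "n \<le> N"
  shows "regular_partitions t n = partitions_in {k \<in> {0<..N}. \<not> t dvd k} n"
proof -
  have "k \<le> N" if "k \<in># p" "sum_mset p = n" for k p
    using that assms by (auto dest!: multi_member_split)
  thus ?thesis by (auto simp: regular_partitions_def partitions_in_def)
qed

lemma fps_nth_prod_multiples_eq_0:
  assumes "finite A" "\<And>a. a \<in> A \<Longrightarrow> t dvd a" "\<not> t dvd n"
  shows "fps_nth (\<Prod>a\<in>A. 1 - fps_X ^ a :: 'a::comm_ring_1 fps) n = 0"
  using assms
proof (induction A arbitrary: n rule: finite_induct)
  case empty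
  thus ?case by (cases n) auto
next
  case (insert a A)
  have "\<not> t dvd n - a" if "a \<le> n"
    using that insert.prems by (metis dvd_diffD insertI1)
  thus ?case using insert by (simp add: left_diff_distrib fps_X_power_mult_nth)
qed

text \<open>Compares coefficients at \<open>n\<close>: the series \<open>B\<close> cancels the
  factors of the truncated Euler product outside the multiples of \<open>t\<close>, and what remains
  is supported on multiples of \<open>t\<close>.\<close>

lemma pentagonal_recurrence:
  assumes "\<not> t dvd n"
  shows "(\<Sum>i | pentagonal i \<le> n.
            (-1) ^ (Suc i div 2) * int (num_regular_partitions t (n - pentagonal i))) = 0"
proof -
  define A where "A = {k \<in> {0<..n}. \<not> t dvd k}"
  define C where "C = {k \<in> {0<..n}. t dvd k}"
  define B :: "int fps" where "B = partitions_fps A"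
  define P :: "int fps" where "P = (\<Sum>i\<le>2 * n. (-1) ^ (Suc i div 2) * fps_X ^ pentagonal i)"
  have B_nth: "fps_nth B m = int (num_regular_partitions t m)" if "m \<le> n" for m
    using that by (simp add: B_def A_def partitions_fps_def num_regular_partitions_def
                             regular_partitions_eq_partitions_in)
  have "finite C" "finite A" "{0<..n} = C \<union> A" "C \<inter> A = {}" by (auto simp: A_def C_def)
  hence "(\<Prod>j\<in>{0<..n}. 1 - fps_X ^ j) * B = (\<Prod>j\<in>C. 1 - fps_X ^ j) * ((\<Prod>j\<in>A. 1 - fps_X ^ j) * B)"
    by (simp only: prod.union_disjoint mult.assoc)
  also have "(\<Prod>j\<in>A. 1 - fps_X ^ j) * B = 1"
    unfolding B_def by (rule prod_mult_partitions_fps) (auto simp: A_def)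
  finally have "(\<Prod>j\<in>{0<..n}. 1 - fps_X ^ j) * B = (\<Prod>j\<in>C. 1 - fps_X ^ j)"
    by (simp only: mult_1_right)
  moreover have "fps_nth (\<Prod>j\<in>C. 1 - fps_X ^ j :: int fps) n = 0"
    by (rule fps_nth_prod_multiples_eq_0[OF \<open>finite C\<close> _ assms]) (simp add: C_def)
  \<comment> \<open>The coefficient at \<open>n\<close> of a product involves only coefficients up
    to \<open>n\<close>, where \<open>P\<close> agrees with the Euler product.\<close>
  moreover have "fps_nth (P * B) n = fps_nth ((\<Prod>j\<in>{0<..n}. 1 - fps_X ^ j) * B) n"
    unfolding fps_mult_nth P_def
    by (intro sum.cong refl) (simp only: pentagonal_number_theorem_trunc atLeastAtMost_iff)
  ultimately have "fps_nth (P * B) n = 0"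
    by (simp only:)
  moreover have "fps_nth ((-1) ^ e * fps_X ^ w * B) n
      = (if w \<le> n then (-1) ^ e * int (num_regular_partitions t (n - w)) else 0)" for e w
  proof -
    have "fps_nth ((-1) ^ e * fps_X ^ w * B) n = (-1) ^ e * fps_nth (fps_X ^ w * B) n"
      by (cases "even e") simp_all
    thus ?thesis by (simp add: fps_X_power_mult_nth B_nth)
  qed
  ultimately have "(\<Sum>i\<le>2 * n. if pentagonal i \<le> n
      then (-1) ^ (Suc i div 2) * int (num_regular_partitions t (n - pentagonal i)) else 0) = 0"
    by (simp add: P_def sum_distrib_right fps_sum_nth)
  \<comment> \<open>Since \<open>i \<le> pentagonal i\<close>, the range up to \<open>2 n\<close>
    misses no relevant index.\<close>
  moreover have "{i. pentagonal i \<le> n} = {i \<in> {..2 * n}. pentagonal i \<le> n}"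
  proof -
    have "i \<le> 2 * n" if "pentagonal i \<le> n" for i
      using that strict_mono_imp_increasing[OF strict_mono_pentagonal, of i] by linarith
    thus ?thesis by auto
  qed
  ultimately show ?thesis
    by (simp only: sum.inter_filter[OF finite_atMost])
qed

section \<open>Counting even values\<close>

lemma even_num_regular_partitions_ex:
  assumes "\<not> t dvd n" "pentagonal (2 * m) \<le> n" "n < pentagonal (Suc (2 * m))"
  shows "\<exists>i\<le>2 * m. pentagonal i \<le> n \<and> even (num_regular_partitions t (n - pentagonal i))"
proof (rule ccontr)
  assume none: "\<not> ?thesis"
  have iff: "pentagonal i \<le> n \<longleftrightarrow> i \<le> 2 * m" for i
  proof (cases "i \<le> 2 * m")
    case True
    hence "pentagonal i \<le> pentagonal (2 * m)"
      by (simp add: strict_mono_less_eq[OF strict_mono_pentagonal])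
    thus ?thesis using True assms(2) by simp
  next
    case False
    hence "pentagonal (Suc (2 * m)) \<le> pentagonal i"
      by (simp add: strict_mono_less_eq[OF strict_mono_pentagonal])
    thus ?thesis using False assms(3) by simp
  qed
  let ?f = "\<lambda>i. (-1) ^ (Suc i div 2) * int (num_regular_partitions t (n - pentagonal i))"
  have "odd (?f i)" if "i \<le> 2 * m" for i
    using none that by (auto simp: iff)
  hence "{i \<in> {..2 * m}. odd (?f i)} = {..2 * m}" by blast
  \<comment> \<open>There are \<open>2 m + 1\<close> summands, all odd, so their sum cannot be
    zero.\<close>
  hence "odd (sum ?f {..2 * m})" by (subst even_sum_iff) simp_all
  thus False using pentagonal_recurrence[OF assms(1)] by (simp add: iff atMost_def)
qed

text \<open>At least one of \<open>a + 2 j\<close> and \<open>a + 2 j + 1\<close> is not divisible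
  by \<open>t\<close>; choosing one per pair is injective, since halving the offset from
  \<open>a\<close> recovers \<open>j\<close>.\<close>

lemma card_nonmultiples_interval:
  fixes t :: nat
  assumes "t \<ge> 2"
  shows "card {n \<in> {a..<a + 2 * m}. \<not> t dvd n} \<ge> m"
proof -
  let ?g = "\<lambda>j. if t dvd a + 2 * j then Suc (a + 2 * j) else a + 2 * j"
  have "\<not> t dvd Suc k" if "t dvd k" for k
    using that assms
    by (metis Suc_eq_plus1 dvd_add_right_iff nat_dvd_1_iff_1 numeral_le_one_iff semiring_norm(69))
  hence "?g ` {..<m} \<subseteq> {n \<in> {a..<a + 2 * m}. \<not> t dvd n}" by auto
  moreover have "inj_on ?g {..<m}"
    by (rule inj_on_inverseI[where g = "\<lambda>n. (n - a) div 2"]) auto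
  ultimately have "card {..<m} \<le> card {n \<in> {a..<a + 2 * m}. \<not> t dvd n}"
    by (intro card_inj_on_le[of ?g]) auto
  thus ?thesis by simp
qed

text \<open>
  The interval condition says that the number of generalized pentagonal numbers up to \<open>n\<close> is
  \<open>2 m + 1\<close>, hence odd.
\<close>

definition odd_count_nonmultiples :: "nat \<Rightarrow> nat \<Rightarrow> nat set" where
  "odd_count_nonmultiples t M = {n. \<not> t dvd n \<and>
     (\<exists>m\<le>M. pentagonal (2 * m) \<le> n \<and> n < pentagonal (Suc (2 * m)))}"

lemma odd_count_nonmultiples_less:
  assumes "n \<in> odd_count_nonmultiples t M"
  shows "n < pentagonal (Suc (2 * M))"
proof -
  obtain m where m: "m \<le> M" "n < pentagonal (Suc (2 * m))"
    using assms by (auto simp: odd_count_nonmultiples_def)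
  note m(2)
  also have "pentagonal (Suc (2 * m)) \<le> pentagonal (Suc (2 * M))"
    using m(1) by (simp add: strict_mono_less_eq[OF strict_mono_pentagonal])
  finally show ?thesis .
qed

lemma finite_odd_count_nonmultiples: "finite (odd_count_nonmultiples t M)"
  by (rule finite_subset[of _ "{..<pentagonal (Suc (2 * M))}"]) (auto dest: odd_count_nonmultiples_less)

text \<open>The intervals for distinct \<open>m\<close> are disjoint, and the one for
  \<open>m\<close> contributes at least \<open>m\<close> elements.\<close>

lemma card_odd_count_nonmultiples:
  assumes "t \<ge> 2"
  shows "card (odd_count_nonmultiples t M) \<ge> triangle M"
proof (induction M)
  case (Suc M)
  let ?a = "pentagonal (2 * Suc M)"
  let ?I = "{n \<in> {?a..<?a + 2 * Suc M}. \<not> t dvd n}"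
  \<comment> \<open>The interval has odd length; dropping its last point leaves \<open>Suc M\<close>
    pairs.\<close>
  have "pentagonal (Suc (2 * Suc M)) = ?a + 2 * Suc M + 1"
    unfolding pentagonal_even pentagonal_odd by (simp add: power2_eq_square)
  hence "?I \<subseteq> odd_count_nonmultiples t (Suc M)"
    unfolding odd_count_nonmultiples_def by (auto intro!: exI[of _ "Suc M"])
  moreover have "odd_count_nonmultiples t M \<subseteq> odd_count_nonmultiples t (Suc M)"
    unfolding odd_count_nonmultiples_def using le_SucI by blast
  ultimately have sub: "odd_count_nonmultiples t M \<union> ?I \<subseteq> odd_count_nonmultiples t (Suc M)" by blast
  have "pentagonal (Suc (2 * M)) < ?a"
    by (rule strict_monoD[OF strict_mono_pentagonal]) simp
  hence disj: "odd_count_nonmultiples t M \<inter> ?I = {}" by (auto dest: odd_count_nonmultiples_less)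
  have "triangle (Suc M) \<le> card (odd_count_nonmultiples t M) + card ?I"
    using Suc card_nonmultiples_interval[OF assms, of "Suc M" ?a] unfolding triangle_Suc by linarith
  also have "\<dots> = card (odd_count_nonmultiples t M \<union> ?I)"
    using disj by (simp add: card_Un_disjoint finite_odd_count_nonmultiples)
  also have "\<dots> \<le> card (odd_count_nonmultiples t (Suc M))"
    by (rule card_mono[OF finite_odd_count_nonmultiples sub])
  finally show ?case .
qed simp

text \<open>Double counting: each admissible \<open>n\<close> is \<open>e + pentagonal i\<close>
  with \<open>e\<close> in \<open>E\<close> and \<open>i \<le> 2 M\<close>, so a quadratic number of
  \<open>n\<close> is covered by \<open>2 M + 1\<close> translates of \<open>E\<close>.\<close>

lemma card_even_ge:
  fixes t M :: nat
  assumes "t \<ge> 2"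
  defines "E \<equiv> {n. n < pentagonal (Suc (2 * M)) \<and> even (num_regular_partitions t n)}"
  shows "M \<le> 4 * card E"
proof -
  have finE: "finite E" by (simp add: E_def)
  have "odd_count_nonmultiples t M \<subseteq> (\<lambda>(i, e). e + pentagonal i) ` ({..2 * M} \<times> E)"
  proof
    fix n assume n: "n \<in> odd_count_nonmultiples t M"
    then obtain m where "\<not> t dvd n" "m \<le> M" "pentagonal (2 * m) \<le> n" "n < pentagonal (Suc (2 * m))"
      by (auto simp: odd_count_nonmultiples_def)
    then obtain i where "i \<le> 2 * M" "pentagonal i \<le> n" "even (num_regular_partitions t (n - pentagonal i))"
      using even_num_regular_partitions_ex[of t n m] by (meson mult_le_mono2 order_trans)
    thus "n \<in> (\<lambda>(i, e). e + pentagonal i) ` ({..2 * M} \<times> E)"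
      using odd_count_nonmultiples_less[OF n]
      by (auto simp: E_def intro!: image_eqI[of _ _ "(i, n - pentagonal i)"])
  qed
  hence "card (odd_count_nonmultiples t M) \<le> card ({..2 * M} \<times> E)"
    using finE by (intro surj_card_le) auto
  hence "triangle M \<le> Suc (2 * M) * card E"
    using card_odd_count_nonmultiples[OF assms(1), of M] by (simp add: card_cartesian_product)
  moreover have "2 * triangle M = M * Suc M"
    by (induction M) simp_all
  ultimately have "M * Suc M \<le> 2 * (Suc (2 * M) * card E)"
    by linarith
  also have "\<dots> \<le> (4 * card E) * Suc M"
    by (simp add: algebra_simps)
  finally show ?thesis by (metis mult_le_cancel2 zero_less_Suc)
qed

lemma pentagonal_le:
  assumes "M > 0"
  shows "pentagonal (Suc (2 * M)) \<le> 5 * M\<^sup>2"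
proof -
  have "triangle M \<le> M\<^sup>2"
    using assms div_le_mono[of "M * Suc M" "2 * (M * M)" 2]
    by (simp add: triangle_def power2_eq_square)
  moreover have "(Suc M)\<^sup>2 \<le> (2 * M)\<^sup>2"
    using assms by (intro power_mono) auto
  ultimately show ?thesis
    unfolding pentagonal_odd by (simp add: power_mult_distrib)
qed

text \<open>The constant comes from \<open>24 = 4 * 2 * 3\<close>: 4 from
  \<open>card_even_ge\<close>, 2 from rounding \<open>sqrt (X / 5)\<close> down, and 3 as an upper
  bound for \<open>sqrt 5\<close>.\<close>

theorem card_even_num_regular_partitions_ge:
  fixes t :: nat and X :: real
  assumes "t \<ge> 2" "X \<ge> 5"
  shows "real (card {n :: nat. real n \<le> X \<and> even (num_regular_partitions t n)}) \<ge> 1 / 24 * sqrt X"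
proof -
  \<comment> \<open>By \<open>pentagonal_le\<close>, this choice keeps the range of
    \<open>card_even_ge\<close> below \<open>X\<close>; \<open>X \<ge> 5\<close> ensures
    \<open>M \<ge> 1\<close>.\<close>
  define M where "M = nat \<lfloor>sqrt (X / 5)\<rfloor>"
  have ge1: "sqrt (X / 5) \<ge> 1" using assms by simp
  have M: "real M \<le> sqrt (X / 5)" "sqrt (X / 5) \<le> 2 * real M" "M > 0"
  proof -
    have "\<lfloor>sqrt (X / 5)\<rfloor> \<ge> 1" using ge1 by simp
    hence "real M = real_of_int \<lfloor>sqrt (X / 5)\<rfloor>" "M > 0" by (simp_all add: M_def)
    thus "real M \<le> sqrt (X / 5)" "sqrt (X / 5) \<le> 2 * real M" "M > 0"
      using floor_correct[of "sqrt (X / 5)"] by linarith+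
  qed
  have "real (5 * M\<^sup>2) \<le> 5 * (sqrt (X / 5))\<^sup>2"
    using power_mono[OF M(1), of 2] by simp
  also have "\<dots> = X" using assms by simp
  finally have "real (pentagonal (Suc (2 * M))) \<le> X"
    using pentagonal_le[OF M(3)] by linarith
  hence "{n. n < pentagonal (Suc (2 * M)) \<and> even (num_regular_partitions t n)}
      \<subseteq> {n. real n \<le> X \<and> even (num_regular_partitions t n)}"
    by auto
  moreover have "finite {n. real n \<le> X \<and> even (num_regular_partitions t n)}"
    by (rule finite_subset[of _ "{..nat \<lfloor>X\<rfloor>}"]) (auto simp: le_nat_floor)
  ultimately have "M \<le> 4 * card {n. real n \<le> X \<and> even (num_regular_partitions t n)}"
    using card_even_ge[OF assms(1), of M] card_mono
    by (meson mult_le_mono2 order_trans)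
  hence "sqrt (X / 5) \<le> 8 * real (card {n. real n \<le> X \<and> even (num_regular_partitions t n)})"
    using M(2) by linarith
  moreover have "sqrt X / 3 \<le> sqrt (X / 5)"
  proof -
    have "sqrt X / 3 = sqrt (X / 9)" by (simp add: real_sqrt_divide)
    also have "\<dots> \<le> sqrt (X / 5)" using assms by simp
    finally show ?thesis .
  qed
  ultimately show ?thesis by linarith
qed

theorem theorem1p11:
  fixes t :: nat
  assumes "t \<in> {6, 10}"
  shows "\<exists>c>0. \<forall>\<^sub>F X :: real in at_top.
           real (card {n :: nat. real n \<le> X \<and> even (num_regular_partitions t n)}) \<ge> c * sqrt X"
proof (intro exI conjI)
  show "\<forall>\<^sub>F X :: real in at_top.
      real (card {n :: nat. real n \<le> X \<and> even (num_regular_partitions t n)}) \<ge> 1 / 24 * sqrt X"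
    using eventually_ge_at_top[of "5 :: real"]
    by eventually_elim (rule card_even_num_regular_partitions_ge, use assms in auto)
qed simp

end
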